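(* Let $w>0$, let $(x(s),z(s))$ be a plane curve parametrized by arc length, and let $$\phi(s,t)=(x(s)\cos(wt)+z(s)\sin(wt),\ t,\ -x(s)\sin(wt)+z(s)\cos(wt)).$$ Put $\xi_1=xx'+zz'$ and $\xi_2=-xz'+zx'$. Then $\phi$ has mean curvature $1$ if and only if $$\xi_1'(s)=f_1(\xi_1(s),\xi_2(s)),\qquad \xi_2'(s)=f_2(\xi_1(s),\xi_2(s)),$$ where $$f_1(x_1,x_2)=\frac{-w^2x_2+2(1+w^2x_1^2)^{3/2}}{1+w^2(x_1^2+x_2^2)}\,x_2+1,\qquad f_2(x_1,x_2)=\frac{w^2x_2-2(1+w^2x_1^2)^{3/2}}{1+w^2(x_1^2+x_2^2)}\,x_1 .$$ Moreover, the function $h_w(x_1,x_2)=x_1^2+x_2^2+\frac{x_2}{\sqrt{1+w^2x_1^2}}$ is a first integral of this system: for every solution $(\xi_1(s),\xi_2(s))$, $h_w(\xi_1(s),\xi_2(s))$ is constant in $s$.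
   Context: All functions are smooth. The mean curvature is half the sum of the principal curvatures, computed with respect to the Gauss map $\nu=\frac{\phi_s\times\phi_t}{|\phi_s\times\phi_t|}$. *)

theory Defs
  imports "HOL-Analysis.Analysis"
begin

text \<open>Smoothness of a real function on a set; intended for open sets only, since \<open>deriv\<close>
  is the two-sided derivative.\<close>

definition smooth_on_reals :: "real set \<Rightarrow> (real \<Rightarrow> real) \<Rightarrow> bool"
  where "smooth_on_reals S f \<longleftrightarrow> (\<forall>n. \<forall>s\<in>S. ((deriv ^^ n) f) differentiable (at s))"

definition gauss_map :: "(real \<times> real \<Rightarrow> real ^ 3) \<Rightarrow> real \<times> real \<Rightarrow> real ^ 3"
  where "gauss_map \<phi> p =
    (let \<phi>s = frechet_derivative \<phi> (at p) (1, 0);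
         \<phi>t = frechet_derivative \<phi> (at p) (0, 1)
     in cross3 \<phi>s \<phi>t /\<^sub>R norm (cross3 \<phi>s \<phi>t))"

text \<open>The principal curvatures at \<open>p\<close> are the eigenvalues, with multiplicity, of the shape operator
  \<open>- d\<nu>\<close>: there is an orthonormal basis \<open>d\<phi> a, d\<phi> b\<close> of the tangent plane with
  \<open>d\<nu> a = - k\<^sub>1 d\<phi> a\<close> and \<open>d\<nu> b = - k\<^sub>2 d\<phi> b\<close>.\<close>

definition principal_curvatures ::
    "(real \<times> real \<Rightarrow> real ^ 3) \<Rightarrow> real \<times> real \<Rightarrow> real \<Rightarrow> real \<Rightarrow> bool"
  where "principal_curvatures \<phi> p k\<^sub>1 k\<^sub>2 \<longleftrightarrow>
    (let d\<phi> = frechet_derivative \<phi> (at p);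
         d\<nu> = frechet_derivative (gauss_map \<phi>) (at p)
     in \<exists>a b. norm (d\<phi> a) = 1 \<and> norm (d\<phi> b) = 1 \<and> inner (d\<phi> a) (d\<phi> b) = 0 \<and>
          d\<nu> a = - (k\<^sub>1 *\<^sub>R d\<phi> a) \<and> d\<nu> b = - (k\<^sub>2 *\<^sub>R d\<phi> b))"

text \<open>The value is meaningful where \<open>\<phi>\<close> is a smooth immersion near \<open>p\<close>: there the principal
  curvatures exist and are unique up to order.\<close>

definition mean_curvature :: "(real \<times> real \<Rightarrow> real ^ 3) \<Rightarrow> real \<times> real \<Rightarrow> real"
  where "mean_curvature \<phi> p =
    (THE H. \<exists>k\<^sub>1 k\<^sub>2. principal_curvatures \<phi> p k\<^sub>1 k\<^sub>2 \<and> H = (k\<^sub>1 + k\<^sub>2) / 2)"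

definition helicoidal :: "real \<Rightarrow> (real \<Rightarrow> real) \<Rightarrow> (real \<Rightarrow> real) \<Rightarrow> real \<times> real \<Rightarrow> real ^ 3"
  where "helicoidal w x z = (\<lambda>(s, t). vector
    [x s * cos (w * t) + z s * sin (w * t), t, - x s * sin (w * t) + z s * cos (w * t)])"

definition xi1 :: "(real \<Rightarrow> real) \<Rightarrow> (real \<Rightarrow> real) \<Rightarrow> real \<Rightarrow> real"
  where "xi1 x z s = x s * deriv x s + z s * deriv z s"

definition xi2 :: "(real \<Rightarrow> real) \<Rightarrow> (real \<Rightarrow> real) \<Rightarrow> real \<Rightarrow> real"
  where "xi2 x z s = - x s * deriv z s + z s * deriv x s"

definition f1 :: "real \<Rightarrow> real \<Rightarrow> real \<Rightarrow> real"
  where "f1 w x1 x2 =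
    (- w\<^sup>2 * x2 + 2 * (1 + w\<^sup>2 * x1\<^sup>2) powr (3 / 2)) / (1 + w\<^sup>2 * (x1\<^sup>2 + x2\<^sup>2)) * x2 + 1"

definition f2 :: "real \<Rightarrow> real \<Rightarrow> real \<Rightarrow> real"
  where "f2 w x1 x2 =
    (w\<^sup>2 * x2 - 2 * (1 + w\<^sup>2 * x1\<^sup>2) powr (3 / 2)) / (1 + w\<^sup>2 * (x1\<^sup>2 + x2\<^sup>2)) * x1"

definition h :: "real \<Rightarrow> real \<Rightarrow> real \<Rightarrow> real"
  where "h w x1 x2 = x1\<^sup>2 + x2\<^sup>2 + x2 / sqrt (1 + w\<^sup>2 * x1\<^sup>2)"

definition solves_system :: "real \<Rightarrow> real set \<Rightarrow> (real \<Rightarrow> real) \<Rightarrow> (real \<Rightarrow> real) \<Rightarrow> bool"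
  where "solves_system w I u v \<longleftrightarrow>
    (\<forall>s\<in>I. (u has_real_derivative f1 w (u s) (v s)) (at s within I) \<and>
            (v has_real_derivative f2 w (u s) (v s)) (at s within I))"

end

theory Submission
  imports Defs
begin

text \<open>
  Turning the coordinate axes by the angle \<open>w t\<close> about the second axis gives an orthonormal frame in
  which all first and second order data of the surface are functions of \<open>s\<close> alone (\<open>inner_twist\<close>,
  \<open>cross3_twist\<close>, \<open>has_derivative_twist\<close>). Together with the classical expression of the mean
  curvature by the coefficients of the two fundamental forms (\<open>mean_curvature_eq\<close>) this gives
  (\<open>mean_curvature_helicoidal\<close>)
  \<open>H = (\<kappa> (1 + w\<^sup>2 (\<xi>\<^sub>1\<^sup>2 + \<xi>\<^sub>2\<^sup>2)) + w\<^sup>2 \<xi>\<^sub>2) / (2 (1 + w\<^sup>2 \<xi>\<^sub>1\<^sup>2) sqrt (1 + w\<^sup>2 \<xi>\<^sub>1\<^sup>2))\<close>,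
  where \<open>\<kappa>\<close> is the signed curvature of the curve \<open>(x, z)\<close>. Thus \<open>H = 1\<close> prescribes \<open>\<kappa>\<close> as a function
  \<open>K(\<xi>\<^sub>1, \<xi>\<^sub>2)\<close>, called \<open>cmc_curvature\<close> below.

  For every unit-speed curve the Frenet equations give \<open>\<xi>\<^sub>1' = \<kappa> \<xi>\<^sub>2 + 1\<close> and \<open>\<xi>\<^sub>2' = - \<kappa> \<xi>\<^sub>1\<close>, and the
  system in the theorem is obtained from these by writing \<open>K\<close> for \<open>\<kappa>\<close>. So \<open>\<kappa> = K\<close> implies the system.
  Conversely the system implies \<open>\<kappa> = K\<close> wherever \<open>(\<xi>\<^sub>1, \<xi>\<^sub>2)\<close> is nonzero, that is, away from the
  parameters at which the curve meets the origin; as \<open>\<xi>\<^sub>1' = 1\<close> there, these are isolated, and the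
  equality follows by continuity (\<open>solves_system_iff\<close>).

  That \<open>h\<close> is a first integral is a direct computation of its derivative along a solution
  (\<open>h_first_integral\<close>).
\<close>

section \<open>Mean curvature from the fundamental forms\<close>

text \<open>The discriminant \<open>E G - F\<^sup>2\<close> of the first fundamental form is the squared length of
  \<open>\<phi>\<^sub>s \<times> \<phi>\<^sub>t\<close>.\<close>

lemma cross3_sq_eq: fixes u v :: "real^3"
  shows "inner (cross3 u v) (cross3 u v) = inner u u * inner v v - (inner u v)\<^sup>2"
  using norm_cross_dot[of u v] by (simp add: power2_norm_eq_inner norm_eq_sqrt_inner power_mult_distrib)

lemma vec3_eq_0_if_orthogonal:
  fixes y u v :: "real^3"
  assumes "inner y u = 0" "inner y v = 0" "inner y (cross3 u v) = 0" "cross3 u v \<noteq> 0"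
  shows "y = 0"
proof -
  have "cross3 y (cross3 u v) = 0"
    by (simp add: Lagrange assms)
  moreover have "(norm (cross3 y (cross3 u v)))\<^sup>2 + (inner y (cross3 u v))\<^sup>2 
      = (norm y * norm (cross3 u v))\<^sup>2"
    using norm_cross_dot by blast
  ultimately show ?thesis using assms by simp
qed

lemma linear_pair_expand:
  fixes A :: "real \<times> real \<Rightarrow> real^3"
  assumes "linear A"
  shows "A v = fst v *\<^sub>R A (1,0) + snd v *\<^sub>R A (0,1)"
proof -
  have "A v = A (fst v *\<^sub>R (1,0) + snd v *\<^sub>R (0,1))" by simp
  then show ?thesis by (simp only: linear_add[OF assms] linear_scale[OF assms])
qed

text \<open>Gram--Schmidt, carried out on the images \<open>A (1,0)\<close> and \<open>A (0,1)\<close>; since \<open>A\<close> is linear, every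
  step can be pulled back to the parameter plane.\<close>

lemma orthonormal_preimages:
  fixes A :: "real \<times> real \<Rightarrow> real^3"
  assumes A: "linear A" and n: "cross3 (A (1,0)) (A (0,1)) \<noteq> 0"
  obtains a b where "norm (A a) = 1" "norm (A b) = 1" "inner (A a) (A b) = 0"
proof -
  define a1 where "a1 = A (1,0)"
  define a2 where "a2 = A (0,1)"
  define E where "E = inner a1 a1"
  define F where "F = inner a1 a2"
  define c where "c = a2 - (F / E) *\<^sub>R a1"
  have a1: "a1 \<noteq> 0" using n by (auto simp: a1_def)
  then have E: "E \<noteq> 0" by (simp add: E_def)
  have "cross3 a1 c = cross3 a1 a2"
    by (simp add: c_def Cross3.right_diff_distrib cross_mult_right)
  then have c: "c \<noteq> 0" using n by (auto simp: a1_def a2_def)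
  have orth: "inner a1 c = 0"
    using E by (simp add: c_def inner_diff_right F_def[symmetric] E_def[symmetric])
  have Ac: "A (- F / E, 1) = c"
    by (subst linear_pair_expand[OF A]) (simp add: c_def a1_def a2_def)
  show ?thesis
  proof
    show "norm (A ((1 / norm a1) *\<^sub>R (1,0))) = 1"
      using a1 by (simp only: linear_scale[OF A] a1_def[symmetric]) simp
    show "norm (A ((1 / norm c) *\<^sub>R (- F / E, 1))) = 1"
      using c by (simp only: linear_scale[OF A] Ac) simp
    show "inner (A ((1 / norm a1) *\<^sub>R (1,0))) (A ((1 / norm c) *\<^sub>R (- F / E, 1))) = 0"
      using orth by (simp only: linear_scale[OF A] Ac a1_def[symmetric]) simp
  qed
qed

text \<open>A symmetric matrix with rows \<open>(p, q)\<close> and \<open>(q, r)\<close> becomes diagonal after rotating the basis by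
  a suitable \<open>\<theta>\<close>. The off-diagonal entry of the rotated matrix is \<open>q\<close> at \<open>\<theta> = 0\<close> and \<open>- q\<close> at
  \<open>\<theta> = \<pi>/2\<close>, where the two axes have been exchanged up to sign, so it vanishes in between.\<close>

lemma principal_axes_angle:
  fixes p q r :: real
  obtains \<theta> where "q * ((cos \<theta>)\<^sup>2 - (sin \<theta>)\<^sup>2) + (r - p) * (cos \<theta> * sin \<theta>) = 0"
proof -
  define g where "g \<theta> = q * ((cos \<theta>)\<^sup>2 - (sin \<theta>)\<^sup>2) + (r - p) * (cos \<theta> * sin \<theta>)" for \<theta>
  have cont: "\<forall>\<theta>. 0 \<le> \<theta> \<and> \<theta> \<le> pi/2 \<longrightarrow> isCont g \<theta>"
    unfolding g_def[abs_def] by (intro allI impI continuous_intros)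
  have ends: "g 0 = q" "g (pi/2) = - q" by (simp_all add: g_def)
  have "\<exists>\<theta>. g \<theta> = 0"
  proof (cases "q \<le> 0")
    case True
    then show ?thesis using IVT[of g 0 0 "pi/2"] ends cont by auto
  next
    case False
    then show ?thesis using IVT2[of g "pi/2" 0 0] ends cont by auto
  qed
  then show ?thesis using that by (auto simp: g_def)
qed

text \<open>Principal curvatures exist: the second fundamental form \<open>- L u \<bullet> A v\<close> is symmetric, hence
  diagonal in a suitably rotated orthonormal basis \<open>A a, A b\<close> of the tangent plane. For such a basis
  \<open>L a\<close> is orthogonal both to \<open>A b\<close> and to the normal \<open>n\<close>, so it is a multiple of \<open>A a\<close>; likewise
  for \<open>b\<close>.\<close>

lemma ex_orthonormal_eigenbasis:
  fixes A L :: "real \<times> real \<Rightarrow> real^3"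
  defines "n \<equiv> cross3 (A (1,0)) (A (0,1))"
  assumes A: "linear A" and L: "linear L" and n: "n \<noteq> 0"
    and tangential: "inner (L (1,0)) n = 0" "inner (L (0,1)) n = 0"
    and symmetric: "inner (L (0,1)) (A (1,0)) = inner (L (1,0)) (A (0,1))"
  obtains a b k\<^sub>1 k\<^sub>2 where "norm (A a) = 1" "norm (A b) = 1" "inner (A a) (A b) = 0"
    "L a = - (k\<^sub>1 *\<^sub>R A a)" "L b = - (k\<^sub>2 *\<^sub>R A b)"
proof -
  have sym: "inner (L u) (A v) = inner (L v) (A u)" for u v
    unfolding linear_pair_expand[OF A, of u] linear_pair_expand[OF A, of v]
      linear_pair_expand[OF L, of u] linear_pair_expand[OF L, of v]
    using symmetric by (simp add: inner_add_left inner_add_right algebra_simps)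
  have tan: "inner (L u) n = 0" for u
    unfolding linear_pair_expand[OF L, of u] using tangential by (simp add: inner_add_left)
  obtain a0 b0 where o: "norm (A a0) = 1" "norm (A b0) = 1" "inner (A a0) (A b0) = 0"
    using orthonormal_preimages[OF A] n unfolding n_def by blast
  obtain \<theta> where \<theta>: "inner (L a0) (A b0) * ((cos \<theta>)\<^sup>2 - (sin \<theta>)\<^sup>2)
      + (inner (L b0) (A b0) - inner (L a0) (A a0)) * (cos \<theta> * sin \<theta>) = 0"
    by (rule principal_axes_angle)
  define a where "a = cos \<theta> *\<^sub>R a0 + sin \<theta> *\<^sub>R b0"
  define b where "b = (- sin \<theta>) *\<^sub>R a0 + cos \<theta> *\<^sub>R b0"
  have Aab: "A a = cos \<theta> *\<^sub>R A a0 + sin \<theta> *\<^sub>R A b0" "A b = (- sin \<theta>) *\<^sub>R A a0 + cos \<theta> *\<^sub>R A b0"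
    unfolding a_def b_def by (simp_all only: linear_add[OF A] linear_scale[OF A])
  have Lab: "L a = cos \<theta> *\<^sub>R L a0 + sin \<theta> *\<^sub>R L b0"
    unfolding a_def by (simp only: linear_add[OF L] linear_scale[OF L])
  have o': "inner (A a0) (A a0) = 1" "inner (A b0) (A b0) = 1" "inner (A b0) (A a0) = 0"
    using o by (simp_all add: norm_eq_1 inner_commute)
  have on: "inner (A a) (A a) = 1" "inner (A b) (A b) = 1" "inner (A a) (A b) = 0"
    unfolding Aab using o o' 
    by (simp_all add: inner_add_left inner_add_right inner_diff_left inner_diff_right
        flip: power2_eq_square)
  have off: "inner (L a) (A b) = 0"
    unfolding Lab Aab using \<theta> sym[of b0 a0]
    by (simp add: inner_add_left inner_add_right power2_eq_square algebra_simps)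
  have off': "inner (L b) (A a) = 0" using off sym by simp
  have "cross3 (A a) (A b) = (fst a * snd b - snd a * fst b) *\<^sub>R n"
    unfolding linear_pair_expand[OF A, of a] linear_pair_expand[OF A, of b] n_def
    by (simp add: cross_add_left cross_add_right cross_mult_left cross_mult_right
        cross_skew[of "A (0,1)" "A (1,0)"] algebra_simps)
  then have tan': "inner (L u) (cross3 (A a) (A b)) = 0" for u
    using tan by simp
  have "inner (cross3 (A a) (A b)) (cross3 (A a) (A b)) = 1"
    unfolding cross3_sq_eq on by simp
  then have nz: "cross3 (A a) (A b) \<noteq> 0" by auto
  define k\<^sub>1 where "k\<^sub>1 = - inner (L a) (A a)"
  define k\<^sub>2 where "k\<^sub>2 = - inner (L b) (A b)"
  have "L a + k\<^sub>1 *\<^sub>R A a = 0"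
    by (rule vec3_eq_0_if_orthogonal[OF _ _ _ nz])
      (use on off tan' in \<open>simp_all add: k\<^sub>1_def inner_diff_left dot_cross_self\<close>)
  moreover have "L b + k\<^sub>2 *\<^sub>R A b = 0"
    by (rule vec3_eq_0_if_orthogonal[OF _ _ _ nz])
      (use on off' tan' in \<open>simp_all add: k\<^sub>2_def inner_diff_left dot_cross_self
        inner_commute[of "A b" "A a"]\<close>)
  ultimately show ?thesis
    using that[of a b k\<^sub>1 k\<^sub>2] on by (simp add: norm_eq_1 eq_neg_iff_add_eq_0)
qed

text \<open>The eigenvalue sum is a trace and does not depend on the eigenbasis. Let \<open>P\<close> be the matrix
  with columns \<open>a, b\<close>, and \<open>M\<close>, \<open>N\<close> the matrices of the first and second fundamental forms.
  Orthonormality says \<open>P\<^sup>T M P = 1\<close>, so \<open>P P\<^sup>T = inverse M\<close>, and the sum is the trace of \<open>P\<^sup>T N P\<close>,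
  which is the trace of \<open>inverse M N\<close>. The entries of \<open>P P\<^sup>T\<close> are found below by clearing
  denominators, with \<open>d = det P\<close> and \<open>d\<^sup>2 (E G - F\<^sup>2) = 1\<close>.\<close>

lemma eigenvalue_sum_eq:
  fixes A L :: "real \<times> real \<Rightarrow> real^3"
  assumes A: "linear A" and L: "linear L"
    and on: "norm (A a) = 1" "norm (A b) = 1" "inner (A a) (A b) = 0"
    and eig: "L a = - (k\<^sub>1 *\<^sub>R A a)" "L b = - (k\<^sub>2 *\<^sub>R A b)"
    and symmetric: "inner (L (0,1)) (A (1,0)) = inner (L (1,0)) (A (0,1))"
    and E: "E = inner (A (1,0)) (A (1,0))" and F: "F = inner (A (1,0)) (A (0,1))"
    and G: "G = inner (A (0,1)) (A (0,1))"
    and e: "e = - inner (L (1,0)) (A (1,0))" and f: "f = - inner (L (1,0)) (A (0,1))"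
    and g: "g = - inner (L (0,1)) (A (0,1))"
  shows "k\<^sub>1 + k\<^sub>2 = (e * G - 2 * f * F + g * E) / (E * G - F\<^sup>2)"
proof -
  obtain a1 a2 where a: "a = (a1, a2)" by (rule prod.exhaust)
  obtain b1 b2 where b: "b = (b1, b2)" by (rule prod.exhaust)
  define d where "d = a1 * b2 - a2 * b1"
  have Aa: "A a = a1 *\<^sub>R A (1,0) + a2 *\<^sub>R A (0,1)" and Ab: "A b = b1 *\<^sub>R A (1,0) + b2 *\<^sub>R A (0,1)"
    and La: "L a = a1 *\<^sub>R L (1,0) + a2 *\<^sub>R L (0,1)" and Lb: "L b = b1 *\<^sub>R L (1,0) + b2 *\<^sub>R L (0,1)"
    using linear_pair_expand[OF A, of a] linear_pair_expand[OF A, of b]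
      linear_pair_expand[OF L, of a] linear_pair_expand[OF L, of b]
    unfolding a b fst_conv snd_conv by simp_all
  have on': "inner (A a) (A a) = 1" "inner (A b) (A b) = 1" using on by (simp_all add: norm_eq_1)
  have I: "E * a1\<^sup>2 + 2 * F * a1 * a2 + G * a2\<^sup>2 = 1" "E * b1\<^sup>2 + 2 * F * b1 * b2 + G * b2\<^sup>2 = 1"
    "E * a1 * b1 + F * (a1 * b2 + a2 * b1) + G * a2 * b2 = 0"
    using on' on(3) unfolding Aa Ab E F G
    by (simp_all add: inner_add_left inner_add_right inner_commute[of "A (0,1)" "A (1,0)"]
        power2_eq_square algebra_simps)
  have "k\<^sub>1 = - inner (L a) (A a)" "k\<^sub>2 = - inner (L b) (A b)"
    using eig on' by simp_all
  then have k: "k\<^sub>1 = e * a1\<^sup>2 + 2 * f * a1 * a2 + g * a2\<^sup>2"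
    "k\<^sub>2 = e * b1\<^sup>2 + 2 * f * b1 * b2 + g * b2\<^sup>2"
    unfolding Aa Ab La Lb e f g using symmetric
    by (simp_all add: inner_add_left inner_add_right power2_eq_square algebra_simps)
  \<comment> \<open>\<open>G d\<^sup>2\<close> is the squared length of the image of \<open>b1 a - a1 b = (0, - d)\<close>, expanded in two ways;
    \<open>E d\<^sup>2\<close> comes in the same way from \<open>b2 a - a2 b = (d, 0)\<close>, and \<open>- F d\<^sup>2\<close> from the inner product
    of the two images.\<close>
  have Gd: "G * d\<^sup>2 = a1\<^sup>2 + b1\<^sup>2"
  proof -
    have "G * d\<^sup>2 = b1\<^sup>2 * (E * a1\<^sup>2 + 2 * F * a1 * a2 + G * a2\<^sup>2)
        - 2 * a1 * b1 * (E * a1 * b1 + F * (a1 * b2 + a2 * b1) + G * a2 * b2)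
        + a1\<^sup>2 * (E * b1\<^sup>2 + 2 * F * b1 * b2 + G * b2\<^sup>2)"
      unfolding d_def by algebra
    then show ?thesis using I by simp
  qed
  have Ed: "E * d\<^sup>2 = a2\<^sup>2 + b2\<^sup>2"
  proof -
    have "E * d\<^sup>2 = b2\<^sup>2 * (E * a1\<^sup>2 + 2 * F * a1 * a2 + G * a2\<^sup>2)
        - 2 * a2 * b2 * (E * a1 * b1 + F * (a1 * b2 + a2 * b1) + G * a2 * b2)
        + a2\<^sup>2 * (E * b1\<^sup>2 + 2 * F * b1 * b2 + G * b2\<^sup>2)"
      unfolding d_def by algebra
    then show ?thesis using I by simp
  qed
  have Fd: "F * d\<^sup>2 = - (a1 * a2 + b1 * b2)"
  proof -
    have "F * d\<^sup>2 = - (b1 * b2 * (E * a1\<^sup>2 + 2 * F * a1 * a2 + G * a2\<^sup>2)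
        - (a1 * b2 + a2 * b1) * (E * a1 * b1 + F * (a1 * b2 + a2 * b1) + G * a2 * b2)
        + a1 * a2 * (E * b1\<^sup>2 + 2 * F * b1 * b2 + G * b2\<^sup>2))"
      unfolding d_def by algebra
    then show ?thesis using I by simp
  qed
  have "d \<noteq> 0"
    using Gd Ed I(1) by (auto simp: sum_power2_eq_zero_iff)
  moreover have "(E * G - F\<^sup>2) * d\<^sup>2 * d\<^sup>2 = d\<^sup>2"
  proof -
    have "(E * G - F\<^sup>2) * d\<^sup>2 * d\<^sup>2 = (E * d\<^sup>2) * (G * d\<^sup>2) - (F * d\<^sup>2)\<^sup>2"
      by algebra
    also have "\<dots> = d\<^sup>2" unfolding Ed Gd Fd unfolding d_def by algebra
    finally show ?thesis .
  qed
  ultimately have \<Delta>: "(E * G - F\<^sup>2) * d\<^sup>2 = 1" by simp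
  have "k\<^sub>1 + k\<^sub>2 = e * (a1\<^sup>2 + b1\<^sup>2) + 2 * f * (a1 * a2 + b1 * b2) + g * (a2\<^sup>2 + b2\<^sup>2)"
    unfolding k by algebra
  also have "\<dots> = (e * G - 2 * f * F + g * E) * d\<^sup>2"
    using Gd Ed Fd by algebra
  finally have "(k\<^sub>1 + k\<^sub>2) * (E * G - F\<^sup>2) = e * G - 2 * f * F + g * E"
    using \<Delta> by algebra
  moreover have "E * G - F\<^sup>2 \<noteq> 0" using \<Delta> by auto
  ultimately show ?thesis by (simp add: field_simps)
qed

text \<open>The classical formula \<open>H = (e G - 2 f F + g E) / (2 (E G - F\<^sup>2))\<close>. Since the mean curvature is
  a definite description, both the existence of principal curvatures and the uniqueness of their sum
  enter.\<close>

lemma mean_curvature_eq: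
  fixes \<phi> :: "real \<times> real \<Rightarrow> real^3"
  assumes A: "(\<phi> has_derivative A) (at p)" and L: "(gauss_map \<phi> has_derivative L) (at p)"
    and n: "n = cross3 (A (1,0)) (A (0,1))" "n \<noteq> 0"
    and tangential: "inner (L (1,0)) n = 0" "inner (L (0,1)) n = 0"
    and symmetric: "inner (L (0,1)) (A (1,0)) = inner (L (1,0)) (A (0,1))"
    and E: "E = inner (A (1,0)) (A (1,0))" and F: "F = inner (A (1,0)) (A (0,1))"
    and G: "G = inner (A (0,1)) (A (0,1))"
    and e: "e = - inner (L (1,0)) (A (1,0))" and f: "f = - inner (L (1,0)) (A (0,1))"
    and g: "g = - inner (L (0,1)) (A (0,1))"
  shows "mean_curvature \<phi> p = (e * G - 2 * f * F + g * E) / (2 * (E * G - F\<^sup>2))"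
proof -
  have lin: "linear A" "linear L" using A L by (auto intro: has_derivative_linear)
  have pc: "principal_curvatures \<phi> p k\<^sub>1 k\<^sub>2 \<longleftrightarrow>
      (\<exists>a b. norm (A a) = 1 \<and> norm (A b) = 1 \<and> inner (A a) (A b) = 0 \<and>
          L a = - (k\<^sub>1 *\<^sub>R A a) \<and> L b = - (k\<^sub>2 *\<^sub>R A b))" for k\<^sub>1 k\<^sub>2
    unfolding principal_curvatures_def Let_def
      frechet_derivative_at[OF A, symmetric] frechet_derivative_at[OF L, symmetric] ..
  have half_sum: "(k\<^sub>1 + k\<^sub>2) / 2 = (e * G - 2 * f * F + g * E) / (2 * (E * G - F\<^sup>2))"
    if k: "principal_curvatures \<phi> p k\<^sub>1 k\<^sub>2" for k\<^sub>1 k\<^sub>2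
  proof -
    have "k\<^sub>1 + k\<^sub>2 = (e * G - 2 * f * F + g * E) / (E * G - F\<^sup>2)"
      using k eigenvalue_sum_eq[OF lin _ _ _ _ _ symmetric E F G e f g] unfolding pc by blast
    then show ?thesis by (simp only: divide_divide_eq_left mult.commute)
  qed
  obtain k\<^sub>1 k\<^sub>2 where k: "principal_curvatures \<phi> p k\<^sub>1 k\<^sub>2"
    using ex_orthonormal_eigenbasis[OF lin] n tangential symmetric unfolding pc by metis
  show ?thesis
    unfolding mean_curvature_def
  proof (rule the_equality)
    show "\<exists>k\<^sub>1 k\<^sub>2. principal_curvatures \<phi> p k\<^sub>1 k\<^sub>2 \<and>
        (e * G - 2 * f * F + g * E) / (2 * (E * G - F\<^sup>2)) = (k\<^sub>1 + k\<^sub>2) / 2"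
      using k half_sum[OF k] by metis
  qed (use half_sum in metis)
qed

section \<open>A rotating orthonormal frame\<close>

text \<open>The vector with coordinates \<open>(a, b, c)\<close> in the right-handed orthonormal frame obtained by
  turning the standard basis about the second axis by the angle \<open>\<theta>\<close>. Inner and cross products are
  computed in these coordinates as usual, and differentiation only adds the terms that come from the
  motion of the frame. The
  trigonometric functions of the surface do not appear beyond this section.\<close>

definition twist :: "real \<Rightarrow> real \<Rightarrow> real \<Rightarrow> real \<Rightarrow> real^3"
  where "twist \<theta> a b c =
    vector [a * cos \<theta> + c * sin \<theta>, b, - a * sin \<theta> + c * cos \<theta>]"

lemma helicoidal_eq_twist:
  "helicoidal w x z = (\<lambda>p. twist (w * snd p) (x (fst p)) (snd p) (z (fst p)))"
  by (auto simp: helicoidal_def twist_def)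

lemma inner_twist:
  "inner (twist \<theta> a b c) (twist \<theta> a' b' c') = a * a' + b * b' + c * c'"
proof -
  have "(a * cos \<theta> + c * sin \<theta>) * (a' * cos \<theta> + c' * sin \<theta>) + b * b' +
     (c * cos \<theta> - a * sin \<theta>) * (c' * cos \<theta> - a' * sin \<theta>)
     = (a * a' + c * c') * ((sin \<theta>)\<^sup>2 + (cos \<theta>)\<^sup>2) + b * b'"
    by algebra
  then show ?thesis by (simp add: twist_def inner_vec_def sum_3)
qed

lemma cross3_twist:
  "cross3 (twist \<theta> a b c) (twist \<theta> a' b' c') =
    twist \<theta> (b * c' - c * b') (c * a' - a * c') (a * b' - b * a')"
proof -
  have "(c * cos \<theta> - a * sin \<theta>) * (a' * cos \<theta> + c' * sin \<theta>) -
      (a * cos \<theta> + c * sin \<theta>) * (c' * cos \<theta> - a' * sin \<theta>)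
     = (c * a' - a * c') * ((sin \<theta>)\<^sup>2 + (cos \<theta>)\<^sup>2)"
    by algebra
  then show ?thesis
    by (simp add: twist_def cross3_def vec_eq_iff forall_3 algebra_simps)
qed

lemma scaleR_twist: "r *\<^sub>R twist \<theta> a b c = twist \<theta> (r * a) (r * b) (r * c)"
  by (simp add: twist_def vec_eq_iff forall_3 algebra_simps)

lemma has_derivative_vec_nth_iff:
  fixes f :: "'a::real_normed_vector \<Rightarrow> real^'n"
  shows "(f has_derivative f') (at p) \<longleftrightarrow>
    (\<forall>i. ((\<lambda>q. f q $ i) has_derivative (\<lambda>v. f' v $ i)) (at p))"
  by (subst has_derivative_componentwise_within) (simp add: Basis_vec_def inner_axis)

text \<open>The frame vectors \<open>e\<^sub>1 = twist \<theta> 1 0 0\<close> and \<open>e\<^sub>3 = twist \<theta> 0 0 1\<close> satisfy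
  \<open>d e\<^sub>1 = - e\<^sub>3 d\<theta>\<close> and \<open>d e\<^sub>3 = e\<^sub>1 d\<theta>\<close>.\<close>

lemma has_derivative_twist:
  assumes "(\<theta> has_derivative \<theta>') (at p)" "(a has_derivative a') (at p)"
    "(b has_derivative b') (at p)" "(c has_derivative c') (at p)"
  shows "((\<lambda>p. twist (\<theta> p) (a p) (b p) (c p)) has_derivative
     (\<lambda>v. twist (\<theta> p) (a' v + \<theta>' v * c p) (b' v) (c' v - \<theta>' v * a p))) (at p)"
  unfolding has_derivative_vec_nth_iff forall_3 twist_def vector_3
  by (auto intro!: derivative_eq_intros assms simp: algebra_simps)

section \<open>The system as a condition on the curvature of the profile curve\<close>

text \<open>The curvature that the profile curve must have at a point with \<open>\<xi>\<^sub>1 = a\<close>, \<open>\<xi>\<^sub>2 = b\<close> for the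
  surface to have mean curvature 1 there; the right-hand sides of the system are built from it.\<close>

definition cmc_curvature :: "real \<Rightarrow> real \<Rightarrow> real \<Rightarrow> real"
  where "cmc_curvature w a b =
    (2 * (1 + w\<^sup>2 * a\<^sup>2) powr (3 / 2) - w\<^sup>2 * b) / (1 + w\<^sup>2 * (a\<^sup>2 + b\<^sup>2))"

lemma f1_eq: "f1 w a b = cmc_curvature w a b * b + 1"
  by (simp add: f1_def cmc_curvature_def)

lemma f2_eq: "f2 w a b = - cmc_curvature w a b * a"
  unfolding f2_def cmc_curvature_def minus_divide_left by simp

lemma powr_three_halves: "D powr (3 / 2) = D * sqrt D" if "D > 0" for D :: real
  using that powr_add[of D 1 "1/2"] by (simp add: powr_half_sqrt)

section \<open>The helicoidal surface of a unit-speed curve\<close>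

lemma smooth_on_realsD:
  assumes "smooth_on_reals S f" "s \<in> S"
  shows "(f has_real_derivative deriv f s) (at s)"
    and "(deriv f has_real_derivative deriv (deriv f) s) (at s)"
    and "isCont (deriv (deriv f)) s"
proof -
  have diff: "((deriv ^^ n) f) differentiable (at s)" for n
    using assms by (auto simp: smooth_on_reals_def)
  show "(f has_real_derivative deriv f s) (at s)"
    using diff[of 0] by (simp add: DERIV_deriv_iff_real_differentiable)
  show "(deriv f has_real_derivative deriv (deriv f) s) (at s)"
    using diff[of 1] by (simp add: DERIV_deriv_iff_real_differentiable)
  show "isCont (deriv (deriv f)) s"
    using diff[of 2] by (simp add: numeral_2_eq_2 differentiable_imp_continuous_within)
qed

lemma has_derivative_comp_fst:
  fixes f :: "real \<Rightarrow> real"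
  assumes "(f has_real_derivative d) (at (fst p))"
  shows "((\<lambda>p. f (fst p)) has_derivative (\<lambda>v. d * fst v)) (at p)"
  using DERIV_compose_FDERIV[OF assms has_derivative_fst[OF has_derivative_ident]]
  by (simp add: mult.commute)

locale unit_speed_curve =
  fixes I :: "real set" and x z :: "real \<Rightarrow> real"
  assumes open_I: "open I"
    and smooth_x: "smooth_on_reals I x" and smooth_z: "smooth_on_reals I z"
    and unit_speed: "s \<in> I \<Longrightarrow> (deriv x s)\<^sup>2 + (deriv z s)\<^sup>2 = 1"
begin

text \<open>The signed curvature of the profile curve.\<close>

definition \<kappa> :: "real \<Rightarrow> real"
  where "\<kappa> s = deriv x s * deriv (deriv z) s - deriv z s * deriv (deriv x) s"

lemmas x_deriv = smooth_on_realsD[OF smooth_x] and z_deriv = smooth_on_realsD[OF smooth_z]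

text \<open>Differentiating the unit-speed condition shows that the acceleration is orthogonal to the velocity
  \<open>(x', z')\<close>, hence a multiple of \<open>(- z', x')\<close>.\<close>

lemma frenet:
  assumes s: "s \<in> I"
  shows "deriv (deriv x) s = - \<kappa> s * deriv z s" and "deriv (deriv z) s = \<kappa> s * deriv x s"
proof -
  have "((\<lambda>s. (deriv x s)\<^sup>2 + (deriv z s)\<^sup>2) has_real_derivative
      2 * (deriv x s * deriv (deriv x) s + deriv z s * deriv (deriv z) s)) (at s)"
    by (auto intro!: derivative_eq_intros x_deriv(2)[OF s] z_deriv(2)[OF s])
  then have "((\<lambda>s. 1) has_real_derivative
      2 * (deriv x s * deriv (deriv x) s + deriv z s * deriv (deriv z) s)) (at s)"
    by (rule has_field_derivative_transform_within_open[OF _ open_I s]) (simp add: unit_speed)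
  then have orth: "deriv x s * deriv (deriv x) s + deriv z s * deriv (deriv z) s = 0"
    using DERIV_unique DERIV_const by fastforce
  show "deriv (deriv x) s = - \<kappa> s * deriv z s" "deriv (deriv z) s = \<kappa> s * deriv x s"
    using orth unit_speed[OF s] unfolding \<kappa>_def by algebra+
qed

text \<open>The pair \<open>(\<xi>\<^sub>1, \<xi>\<^sub>2)\<close> is the position vector expressed in the moving frame of the curve, so its
  motion is governed by the curvature alone. This is the system of the theorem with \<open>\<kappa>\<close> in the place of
  \<open>cmc_curvature\<close>.\<close>

lemma xi_deriv:
  assumes s: "s \<in> I"
  shows "(xi1 x z has_real_derivative \<kappa> s * xi2 x z s + 1) (at s)"
    and "(xi2 x z has_real_derivative - \<kappa> s * xi1 x z s) (at s)"
proof -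
  note d = x_deriv(1,2)[OF s] z_deriv(1,2)[OF s]
  have "((\<lambda>s. x s * deriv x s + z s * deriv z s) has_real_derivative \<kappa> s * xi2 x z s + 1) (at s)"
    by (rule derivative_eq_intros d refl)+
      (use unit_speed[OF s] in \<open>simp add: frenet[OF s] xi2_def power2_eq_square algebra_simps\<close>)
  then show "(xi1 x z has_real_derivative \<kappa> s * xi2 x z s + 1) (at s)"
    by (simp add: xi1_def[abs_def])
  have "((\<lambda>s. - x s * deriv z s + z s * deriv x s) has_real_derivative - \<kappa> s * xi1 x z s) (at s)"
    by (rule derivative_eq_intros d refl)+
      (simp add: frenet[OF s] xi1_def algebra_simps)
  then show "(xi2 x z has_real_derivative - \<kappa> s * xi1 x z s) (at s)"
    by (simp add: xi2_def[abs_def])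
qed

lemma xi_norm:
  assumes "s \<in> I"
  shows "(xi1 x z s)\<^sup>2 + (xi2 x z s)\<^sup>2 = (x s)\<^sup>2 + (z s)\<^sup>2"
proof -
  have "(xi1 x z s)\<^sup>2 + (xi2 x z s)\<^sup>2 = ((x s)\<^sup>2 + (z s)\<^sup>2) * ((deriv x s)\<^sup>2 + (deriv z s)\<^sup>2)"
    unfolding xi1_def xi2_def by algebra
  then show ?thesis using unit_speed[OF assms] by simp
qed

lemma has_derivative_helicoidal:
  assumes "fst p \<in> I"
  shows "(helicoidal w x z has_derivative (\<lambda>v. twist (w * snd p)
      (deriv x (fst p) * fst v + w * snd v * z (fst p)) (snd v)
      (deriv z (fst p) * fst v - w * snd v * x (fst p)))) (at p)"
  unfolding helicoidal_eq_twist
  by (intro has_derivative_twist has_derivative_comp_fst x_deriv(1) z_deriv(1) assms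
      has_derivative_mult_right has_derivative_snd has_derivative_ident)

text \<open>The reciprocal of the length of \<open>\<phi>\<^sub>s \<times> \<phi>\<^sub>t\<close>.\<close>

definition normal_scale :: "real \<Rightarrow> real \<Rightarrow> real"
  where "normal_scale w s = inverse (sqrt (1 + w\<^sup>2 * (xi1 x z s)\<^sup>2))"

text \<open>In the frame at angle \<open>w t\<close> the normal \<open>\<phi>\<^sub>s \<times> \<phi>\<^sub>t\<close> is \<open>(- z', w \<xi>\<^sub>1, x')\<close>. It never vanishes,
  so the surface is immersed everywhere.\<close>

lemma gauss_map_helicoidal:
  assumes p: "fst p \<in> I"
  shows "gauss_map (helicoidal w x z) p = twist (w * snd p)
    (- (normal_scale w (fst p) * deriv z (fst p)))
    (normal_scale w (fst p) * (w * xi1 x z (fst p))) (normal_scale w (fst p) * deriv x (fst p))"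
proof -
  let ?s = "fst p"
  let ?n = "twist (w * snd p) (- deriv z ?s) (w * xi1 x z ?s) (deriv x ?s)"
  have "cross3 (twist (w * snd p) (deriv x ?s) 0 (deriv z ?s))
      (twist (w * snd p) (w * z ?s) 1 (- (w * x ?s))) = ?n"
    unfolding cross3_twist by (simp add: xi1_def algebra_simps)
  moreover have "norm ?n = sqrt (1 + w\<^sup>2 * (xi1 x z ?s)\<^sup>2)"
    unfolding norm_eq_sqrt_inner inner_twist using unit_speed[OF p]
    by (simp add: power2_eq_square algebra_simps)
  ultimately show ?thesis
    unfolding gauss_map_def Let_def
      frechet_derivative_at[OF has_derivative_helicoidal[OF p], symmetric]
    by (simp add: scaleR_twist normal_scale_def)
qed

lemma normal_scale_deriv:
  assumes s: "s \<in> I"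
  shows "(normal_scale w has_real_derivative
    - (w\<^sup>2 * xi1 x z s * (\<kappa> s * xi2 x z s + 1)) * (normal_scale w s) ^ 3) (at s)"
proof -
  let ?D = "\<lambda>s. 1 + w\<^sup>2 * (xi1 x z s)\<^sup>2"
  have D: "?D s > 0" by (simp add: add_pos_nonneg)
  have dD: "(?D has_real_derivative w\<^sup>2 * (2 * xi1 x z s * (\<kappa> s * xi2 x z s + 1))) (at s)"
    by (auto intro!: derivative_eq_intros xi_deriv(1)[OF s])
  have dsqrt: "((\<lambda>s. sqrt (?D s)) has_real_derivative
      inverse (sqrt (?D s)) / 2 * (w\<^sup>2 * (2 * xi1 x z s * (\<kappa> s * xi2 x z s + 1)))) (at s)"
    using DERIV_chain2[OF DERIV_real_sqrt dD] D by simp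
  have "((\<lambda>s. inverse (sqrt (?D s))) has_real_derivative
    - (w\<^sup>2 * xi1 x z s * (\<kappa> s * xi2 x z s + 1)) * (inverse (sqrt (?D s))) ^ 3) (at s)"
    by (rule DERIV_cong[OF DERIV_inverse'[OF dsqrt]]) (use D in \<open>simp_all add: power3_eq_cube\<close>)
  then show ?thesis by (simp add: normal_scale_def[abs_def])
qed

text \<open>The fundamental forms, with \<open>r\<close> the reciprocal of the length of the normal, are
  \<open>E = 1\<close>, \<open>F = w \<xi>\<^sub>2\<close>, \<open>G = 1 + w\<^sup>2 (\<xi>\<^sub>1\<^sup>2 + \<xi>\<^sub>2\<^sup>2)\<close> and
  \<open>e = r \<kappa>\<close>, \<open>f = - r w\<close>, \<open>g = - r w\<^sup>2 \<xi>\<^sub>2\<close>.\<close>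

lemma mean_curvature_helicoidal:
  assumes s: "s \<in> I"
  shows "mean_curvature (helicoidal w x z) (s, t) =
    normal_scale w s * (\<kappa> s * (1 + w\<^sup>2 * ((xi1 x z s)\<^sup>2 + (xi2 x z s)\<^sup>2)) + w\<^sup>2 * xi2 x z s)
      / (2 * (1 + w\<^sup>2 * (xi1 x z s)\<^sup>2))"
proof -
  define X1 where "X1 = deriv x s"
  define Z1 where "Z1 = deriv z s"
  define k where "k = \<kappa> s"
  define a where "a = xi1 x z s"
  define b where "b = xi2 x z s"
  define r where "r = normal_scale w s"
  define D where "D = 1 + w\<^sup>2 * a\<^sup>2"
  define \<rho> where "\<rho> = - (w\<^sup>2 * a * (k * b + 1)) * r ^ 3"
  have D: "D > 0" unfolding D_def by (simp add: add_pos_nonneg)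
  have r: "r = inverse (sqrt D)" by (simp add: r_def normal_scale_def D_def a_def)
  then have rD: "r\<^sup>2 * D = 1"
    using D by (simp_all add: power_inverse)
  have unit: "X1\<^sup>2 + Z1\<^sup>2 = 1" using unit_speed[OF s] by (simp add: X1_def Z1_def)
  have a: "a = x s * X1 + z s * Z1" and b: "b = - x s * Z1 + z s * X1"
    by (simp_all add: a_def b_def xi1_def xi2_def X1_def Z1_def)
  have ab: "a\<^sup>2 + b\<^sup>2 = (x s)\<^sup>2 + (z s)\<^sup>2" using xi_norm[OF s] by (simp add: a_def b_def)
  let ?A = "\<lambda>v :: real \<times> real. twist (w * t) (X1 * fst v + w * snd v * z s) (snd v)
      (Z1 * fst v - w * snd v * x s)"
  have A: "(helicoidal w x z has_derivative ?A) (at (s, t))"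
    using has_derivative_helicoidal[of "(s, t)" w] s by (simp add: X1_def Z1_def)
  note dr = normal_scale_deriv[OF s, of w, folded a_def b_def k_def r_def, folded \<rho>_def]
  note dx = x_deriv(2)[OF s, unfolded frenet[OF s], folded Z1_def k_def]
  note dz = z_deriv(2)[OF s, unfolded frenet[OF s], folded X1_def k_def]
  note da = xi_deriv(1)[OF s, folded a_def b_def k_def]
  have d1: "((\<lambda>s. - (normal_scale w s * deriv z s)) has_real_derivative - (\<rho> * Z1 + r * (k * X1))) (at s)"
    by (rule derivative_eq_intros dr dz refl)+ (simp add: r_def Z1_def)
  have d2: "((\<lambda>s. normal_scale w s * (w * xi1 x z s)) has_real_derivative
      \<rho> * (w * a) + r * (w * (k * b + 1))) (at s)"
    by (rule derivative_eq_intros dr da refl)+ (simp add: r_def a_def)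
  have d3: "((\<lambda>s. normal_scale w s * deriv x s) has_real_derivative \<rho> * X1 - r * (k * Z1)) (at s)"
    by (rule derivative_eq_intros dr dx refl)+ (simp add: r_def X1_def)
  \<comment> \<open>The differential of the Gauss map, in frame coordinates. The formula for the Gauss map is valid
    only over \<open>I\<close>, which suffices because \<open>I \<times> UNIV\<close> is open.\<close>
  let ?L = "\<lambda>v :: real \<times> real. twist (w * t)
      (- (\<rho> * Z1 + r * (k * X1)) * fst v + w * snd v * (r * X1))
      ((\<rho> * (w * a) + r * (w * (k * b + 1))) * fst v)
      ((\<rho> * X1 - r * (k * Z1)) * fst v + w * snd v * (r * Z1))"
  have "((\<lambda>p. twist (w * snd p) (- (normal_scale w (fst p) * deriv z (fst p)))
    (normal_scale w (fst p) * (w * xi1 x z (fst p))) (normal_scale w (fst p) * deriv x (fst p)))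
    has_derivative ?L) (at (s, t))"
    by (rule has_derivative_eq_rhs, rule has_derivative_twist,
        rule has_derivative_mult_right[OF has_derivative_snd[OF has_derivative_ident]],
        (rule has_derivative_comp_fst; simp; fact d1 d2 d3)+)
      (simp add: X1_def Z1_def r_def)
  then have L: "(gauss_map (helicoidal w x z) has_derivative ?L) (at (s, t))"
    by (rule has_derivative_transform_within_open[OF _ open_Times[OF open_I open_UNIV]])
      (use s in \<open>auto simp: gauss_map_helicoidal\<close>)
  have "mean_curvature (helicoidal w x z) (s, t) =
    ((r * k) * (1 + w\<^sup>2 * (a\<^sup>2 + b\<^sup>2)) - 2 * (- (r * w)) * (w * b) + (- (r * w\<^sup>2 * b)) * 1)
     / (2 * (1 * (1 + w\<^sup>2 * (a\<^sup>2 + b\<^sup>2)) - (w * b)\<^sup>2))"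
  proof (rule mean_curvature_eq[OF A L])
    let ?n = "twist (w * t) (- Z1) (w * a) X1"
    show "?n = cross3 (?A (1, 0)) (?A (0, 1))"
      unfolding cross3_twist by (simp add: a algebra_simps)
    have "inner ?n ?n = D"
      unfolding inner_twist D_def using unit by (simp add: power2_eq_square algebra_simps)
    then show "?n \<noteq> 0" using D by auto
    have "inner (?L (1, 0)) ?n = \<rho> * (Z1\<^sup>2 + X1\<^sup>2 + w\<^sup>2 * a\<^sup>2) + r * w\<^sup>2 * a * (k * b + 1)"
      unfolding inner_twist by (simp add: power2_eq_square algebra_simps)
    also have "\<dots> = \<rho> * D + r * w\<^sup>2 * a * (k * b + 1)"
      using unit by (simp add: D_def add.commute)
    also have "\<dots> = 0"
      unfolding \<rho>_def using rD by algebra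
    finally show "inner (?L (1, 0)) ?n = 0" .
    show "inner (?L (0, 1)) ?n = 0"
      unfolding inner_twist by (simp add: algebra_simps)
    show "inner (?L (0, 1)) (?A (1, 0)) = inner (?L (1, 0)) (?A (0, 1))"
      unfolding inner_twist fst_conv snd_conv using unit a b by algebra
    show "1 = inner (?A (1, 0)) (?A (1, 0))"
      unfolding inner_twist using unit by (simp add: power2_eq_square)
    show "w * b = inner (?A (1, 0)) (?A (0, 1))"
      unfolding inner_twist b by (simp add: algebra_simps)
    show "1 + w\<^sup>2 * (a\<^sup>2 + b\<^sup>2) = inner (?A (0, 1)) (?A (0, 1))"
      unfolding inner_twist ab by (simp add: power2_eq_square algebra_simps)
    show "r * k = - inner (?L (1, 0)) (?A (1, 0))"
      unfolding inner_twist fst_conv snd_conv using unit by algebra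
    show "- (r * w) = - inner (?L (1, 0)) (?A (0, 1))"
      unfolding inner_twist fst_conv snd_conv a b by algebra
    show "- (r * w\<^sup>2 * b) = - inner (?L (0, 1)) (?A (0, 1))"
      unfolding inner_twist b by (simp add: power2_eq_square algebra_simps)
  qed
  also have "\<dots> = r * (k * (1 + w\<^sup>2 * (a\<^sup>2 + b\<^sup>2)) + w\<^sup>2 * b) / (2 * D)"
    by (simp add: D_def power2_eq_square algebra_simps)
  finally show ?thesis unfolding r_def k_def a_def b_def D_def .
qed

text \<open>The mean curvature is affine in \<open>\<kappa>\<close> with positive slope, so the value 1 is attained for exactly
  one curvature.\<close>

lemma mean_curvature_eq_1_iff:
  assumes s: "s \<in> I"
  shows "mean_curvature (helicoidal w x z) (s, t) = 1 \<longleftrightarrow>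
    \<kappa> s = cmc_curvature w (xi1 x z s) (xi2 x z s)"
proof -
  define D where "D = 1 + w\<^sup>2 * (xi1 x z s)\<^sup>2"
  define R where "R = 1 + w\<^sup>2 * ((xi1 x z s)\<^sup>2 + (xi2 x z s)\<^sup>2)"
  have D: "D > 0" unfolding D_def by (simp add: add_pos_nonneg)
  have R: "R > 0" unfolding R_def by (simp add: add_pos_nonneg)
  have "mean_curvature (helicoidal w x z) (s, t) = 
      (\<kappa> s * R + w\<^sup>2 * xi2 x z s) / (2 * (D * sqrt D))"
    unfolding mean_curvature_helicoidal[OF s] normal_scale_def D_def R_def
    by (simp add: field_simps)
  also have "\<dots> = 1 \<longleftrightarrow> \<kappa> s * R = 2 * (D * sqrt D) - w\<^sup>2 * xi2 x z s"
    using D by (auto simp: field_simps)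
  also have "\<dots> \<longleftrightarrow> \<kappa> s = (2 * (D * sqrt D) - w\<^sup>2 * xi2 x z s) / R"
    using R by (auto simp: field_simps)
  finally show ?thesis
    unfolding cmc_curvature_def D_def[symmetric] R_def[symmetric] powr_three_halves[OF D] .
qed

lemma isCont_\<kappa>: "s \<in> I \<Longrightarrow> isCont \<kappa> s"
  unfolding \<kappa>_def[abs_def]
  by (intro continuous_intros x_deriv(3) z_deriv(3) DERIV_isCont[OF x_deriv(2)]
      DERIV_isCont[OF z_deriv(2)])

lemma isCont_cmc_curvature:
  assumes "s \<in> I"
  shows "isCont (\<lambda>s. cmc_curvature w (xi1 x z s) (xi2 x z s)) s"
proof -
  have pos: "1 + w\<^sup>2 * y\<^sup>2 > 0" "1 + w\<^sup>2 * (y\<^sup>2 + y'\<^sup>2) > 0" for y y' :: real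
    by (simp_all add: add_pos_nonneg)
  note xi_cont = xi_deriv[OF assms, THEN DERIV_isCont]
  show ?thesis
    unfolding cmc_curvature_def
    by (intro continuous_intros xi_cont) (use pos in \<open>simp_all add: less_imp_neq[symmetric]\<close>)
qed

text \<open>Comparing the system with the equations that always hold gives
  \<open>(\<kappa> - K) \<xi>\<^sub>1 = 0 = (\<kappa> - K) \<xi>\<^sub>2\<close>, where \<open>K\<close> is the required curvature. This decides \<open>\<kappa> = K\<close> except
  where the curve passes through the origin. There \<open>\<xi>\<^sub>1' = 1\<close>, so such points are isolated and the
  equality extends to them by continuity.\<close>

lemma solves_system_iff:
  "solves_system w I (xi1 x z) (xi2 x z) \<longleftrightarrow>
    (\<forall>s\<in>I. \<kappa> s = cmc_curvature w (xi1 x z s) (xi2 x z s))" (is "?sol \<longleftrightarrow> (\<forall>s\<in>I. \<kappa> s = ?K s)")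
proof
  assume "\<forall>s\<in>I. \<kappa> s = ?K s"
  then show ?sol
    unfolding solves_system_def f1_eq f2_eq
    using xi_deriv by (auto intro: has_field_derivative_at_within)
next
  assume sol: ?sol
  have eq: "\<kappa> y = ?K y" if y: "y \<in> I" and "xi1 x z y \<noteq> 0 \<or> xi2 x z y \<noteq> 0" for y
  proof -
    have "(xi1 x z has_real_derivative ?K y * xi2 x z y + 1) (at y)"
      and "(xi2 x z has_real_derivative - ?K y * xi1 x z y) (at y)"
      using sol y unfolding solves_system_def f1_eq f2_eq
      by (auto simp: at_within_open[OF y open_I])
    then have "?K y * xi2 x z y + 1 = \<kappa> y * xi2 x z y + 1" "- ?K y * xi1 x z y = - \<kappa> y * xi1 x z y"
      using xi_deriv[OF y] DERIV_unique by blast+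
    then show ?thesis using that(2) by auto
  qed
  show "\<forall>s\<in>I. \<kappa> s = ?K s"
  proof
    fix s assume s: "s \<in> I"
    show "\<kappa> s = ?K s"
    proof (cases "xi1 x z s = 0 \<and> xi2 x z s = 0")
      case False
      then show ?thesis using eq[OF s] by blast
    next
      case True
      then have "(xi1 x z has_real_derivative 1) (at s)" using xi_deriv(1)[OF s] by simp
      then have "((\<lambda>y. xi1 x z y / (y - s)) \<longlongrightarrow> 1) (at s)"
        using True by (simp add: has_field_derivative_iff)
      then have "\<forall>\<^sub>F y in at s. xi1 x z y / (y - s) > 0"
        by (rule order_tendstoD) simp
      moreover have "\<forall>\<^sub>F y in at s. y \<in> I"
        using open_I s by (rule eventually_at_in_open')
      ultimately have ev: "\<forall>\<^sub>F y in at s. \<kappa> y = ?K y"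
        by eventually_elim (auto intro: eq)
      have lim: "(\<kappa> \<longlongrightarrow> \<kappa> s) (at s)" "(?K \<longlongrightarrow> ?K s) (at s)"
        using isCont_\<kappa>[OF s] isCont_cmc_curvature[OF s] by (simp_all add: isCont_def)
      have "(?K \<longlongrightarrow> \<kappa> s) (at s)"
        using lim(1) by (rule Lim_transform_eventually) (rule ev)
      then show ?thesis
        using lim(2) by (rule tendsto_unique[OF at_neq_bot])
    qed
  qed
qed

end

section \<open>The first integral\<close>

text \<open>With \<open>D = 1 + w\<^sup>2 u\<^sup>2\<close> and \<open>K\<close> the value of \<open>cmc_curvature\<close> along the solution, the derivative of \<open>h\<close> is
  \<open>u (2 D sqrt D - K (D + w\<^sup>2 v\<^sup>2) - w\<^sup>2 v) / (D sqrt D)\<close>,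
  and \<open>K\<close> is defined so that the bracket is zero.\<close>

lemma h_first_integral:
  assumes J: "is_interval J" and sol: "solves_system w J u v"
  shows "(\<lambda>s. h w (u s) (v s)) constant_on J"
proof -
  have "((\<lambda>s. h w (u s) (v s)) has_field_derivative 0) (at s within J)" if "s \<in> J" for s
  proof -
    define D where "D = 1 + w\<^sup>2 * (u s)\<^sup>2"
    define R where "R = 1 + w\<^sup>2 * ((u s)\<^sup>2 + (v s)\<^sup>2)"
    define K where "K = cmc_curvature w (u s) (v s)"
    have D: "D > 0" unfolding D_def by (simp add: add_pos_nonneg)
    have R: "R > 0" unfolding R_def by (simp add: add_pos_nonneg)
    have du: "(u has_real_derivative K * v s + 1) (at s within J)"
      and dv: "(v has_real_derivative - (K * u s)) (at s within J)"
      using sol that unfolding solves_system_def f1_eq f2_eq K_def by simp_all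
    have S: "sqrt D > 0" "sqrt D * sqrt D = D" using D by simp_all
    have KR: "K * R = 2 * (D * sqrt D) - w\<^sup>2 * v s"
      using R D unfolding K_def cmc_curvature_def D_def[symmetric] R_def[symmetric]
      by (simp add: powr_three_halves)
    have RD: "R = D + w\<^sup>2 * (v s)\<^sup>2" by (simp add: R_def D_def algebra_simps)
    have zero: "2 * u s * (K * v s + 1) + 2 * v s * (- (K * u s)) +
      ((- (K * u s)) * sqrt D - v s * (w\<^sup>2 * (2 * u s * (K * v s + 1)) * (inverse (sqrt D) / 2)))
         / (sqrt D * sqrt D) = 0" (is "?l = 0")
    proof -
      define q where "q = sqrt D"
      have q: "q > 0" "D = q * q" using S by (simp_all add: q_def)
      have "?l = (2 * u s - K * u s / q - w\<^sup>2 * u s * v s * (K * v s + 1) / (q * q * q))"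
        unfolding q_def[symmetric] using q(1) by (simp add: field_simps)
      then have "?l * (D * sqrt D) = u s * (2 * (D * sqrt D) - K * R - w\<^sup>2 * v s)"
        unfolding q_def[symmetric] RD q(2) using q(1)
        by (simp add: field_simps power2_eq_square)
      then have "?l * (D * sqrt D) = 0" unfolding KR by simp
      then show ?thesis using S D by simp
    qed
    have dD: "((\<lambda>s. 1 + w\<^sup>2 * (u s)\<^sup>2) has_real_derivative w\<^sup>2 * (2 * u s * (K * v s + 1)))
        (at s within J)"
      by (auto intro!: derivative_eq_intros du)
    have dsqrt: "((\<lambda>s. sqrt (1 + w\<^sup>2 * (u s)\<^sup>2)) has_real_derivative
        inverse (sqrt D) / 2 * (w\<^sup>2 * (2 * u s * (K * v s + 1)))) (at s within J)"
      using DERIV_chain2[OF DERIV_real_sqrt dD] D by (simp add: D_def)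
    have dr: "((\<lambda>s. v s / sqrt (1 + w\<^sup>2 * (u s)\<^sup>2)) has_real_derivative
        ((- (K * u s)) * sqrt D - v s * (inverse (sqrt D) / 2 * (w\<^sup>2 * (2 * u s * (K * v s + 1)))))
         / (sqrt D * sqrt D)) (at s within J)"
      unfolding D_def
      by (rule DERIV_divide[OF dv dsqrt[unfolded D_def]]) (use S in \<open>simp add: D_def\<close>)
    show ?thesis
      unfolding h_def
      by (rule DERIV_cong[OF DERIV_add[OF DERIV_add[OF DERIV_power[OF du, of 2]
              DERIV_power[OF dv, of 2]] dr]])
        (use zero in \<open>simp add: mult_ac\<close>)
  qed
  then show ?thesis
    using has_field_derivative_zero_constant[OF is_interval_convex[OF J]]
    unfolding constant_on_def by metis
qed

theorem proposition1p4:
  fixes w :: real and x z :: "real \<Rightarrow> real" and I :: "real set"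
  assumes "w > 0"
    and "open I" and "is_interval I"
    and "smooth_on_reals I x" and "smooth_on_reals I z"
    and "\<forall>s\<in>I. (deriv x s)\<^sup>2 + (deriv z s)\<^sup>2 = 1"
  shows "((\<forall>s\<in>I. \<forall>t. mean_curvature (helicoidal w x z) (s, t) = 1)
           \<longleftrightarrow> solves_system w I (xi1 x z) (xi2 x z))
       \<and> (\<forall>J u v. is_interval J \<and> solves_system w J u v
           \<longrightarrow> (\<lambda>s. h w (u s) (v s)) constant_on J)"
proof -
  interpret unit_speed_curve I x z
    using assms by unfold_locales auto
  show ?thesis
    using mean_curvature_eq_1_iff solves_system_iff h_first_integral by auto
qed


end
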